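(* On the interior of $D$, the angle $\theta=f(a,b,c)$ between the two diagonals increases with $c$; that is, $\frac{\partial\theta}{\partial c}=\frac{\partial f}{\partial c}(a,b,c)>0$ for every $(a,b,c)$ in the interior of $D$.
   Context: Coordinates: a point $(a,b,c,\theta)$ with $a,b,c>0$ and $\theta\in(0,\pi)$ encodes the convex quadrilateral $q_1=(1,0)$, $q_2=(a\cos\theta,a\sin\theta)$, $q_3=(-b,0)$, $q_4=(-c\cos\theta,-c\sin\theta)$, whose diagonals meet at the origin at angle $\theta$. With $r_{ij}=\|q_i-q_j\|$: $r_{12}^2=a^2-2a\cos\theta+1$, $r_{23}^2=a^2+2ab\cos\theta+b^2$, $r_{13}=b+1$, $r_{14}^2=c^2+2c\cos\theta+1$, $r_{34}^2=b^2-2bc\cos\theta+c^2$, $r_{24}=a+c$. Let $\mathcal C$ be the set of $(a,b,c,\theta)$ with $a,b,c>0$, $\theta\in(0,\pi)$ such that $r_{13}>r_{12}$, $r_{24}>r_{12}$, $r_{12}\ge r_{14}\ge r_{34}$ and $r_{12}\ge r_{23}\ge r_{34}$. Let $F(a,b,c,\theta)=(r_{24}^3-r_{14}^3)(r_{13}^3-r_{12}^3)(r_{23}^3-r_{34}^3)-(r_{12}^3-r_{14}^3)(r_{24}^3-r_{34}^3)(r_{13}^3-r_{23}^3)$, and $E=\{s\in\mathcal C: F(s)=0\}$ (this set describes the four-body convex central configurations with positive masses, up to isometry, rescaling and relabeling). Let $D=D_1\cup D_2$, where $D_1$ is the set of $(a,b,c)$ with $a,b,c>0$, $c\le a\le 1$,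 $b\le1$, $\frac12(-a+\sqrt{4-3a^2})<c<\frac1a(b^2+2b)$ and $c>-a+\sqrt{a^2+b}$; and $D_2$ is the set of $(a,b,c)$ with $a,b,c>0$, $c\le a$, $a>1$, $b\le 1$, $c<\frac1a(b^2+2b)$, $b>\frac12(-1+\sqrt{4a^2-3})$ and $c>-a+\sqrt{a^2+b}$. For each $(a,b,c)\in D$ there is a unique $\theta\in(0,\pi)$ with $(a,b,c,\theta)\in E$; this value is denoted $f(a,b,c)$, and $f$ is differentiable on the interior of $D$. *)

theory Defs
  imports "HOL-Analysis.Analysis"
begin

text \<open>
  A tuple (a, b, c, \<theta>) encodes the quadrilateral with vertices q1, ..., q4. The plane is
  \<^typ>\<open>real \<times> real\<close>, whose library metric is the Euclidean one.
\<close>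

type_synonym coords = "real \<times> real \<times> real \<times> real"

fun q1 :: "coords \<Rightarrow> real \<times> real" where "q1 (a, b, c, \<theta>) = (1, 0)"
fun q2 :: "coords \<Rightarrow> real \<times> real" where "q2 (a, b, c, \<theta>) = (a * cos \<theta>, a * sin \<theta>)"
fun q3 :: "coords \<Rightarrow> real \<times> real" where "q3 (a, b, c, \<theta>) = (- b, 0)"
fun q4 :: "coords \<Rightarrow> real \<times> real" where "q4 (a, b, c, \<theta>) = (- c * cos \<theta>, - c * sin \<theta>)"

definition r12 :: "coords \<Rightarrow> real" where "r12 s = dist (q1 s) (q2 s)"
definition r13 :: "coords \<Rightarrow> real" where "r13 s = dist (q1 s) (q3 s)"
definition r14 :: "coords \<Rightarrow> real" where "r14 s = dist (q1 s) (q4 s)"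
definition r23 :: "coords \<Rightarrow> real" where "r23 s = dist (q2 s) (q3 s)"
definition r24 :: "coords \<Rightarrow> real" where "r24 s = dist (q2 s) (q4 s)"
definition r34 :: "coords \<Rightarrow> real" where "r34 s = dist (q3 s) (q4 s)"

lemma r12_squared: "(r12 (a, b, c, \<theta>))\<^sup>2 = a\<^sup>2 - 2 * a * cos \<theta> + 1"
proof -
  have "(r12 (a, b, c, \<theta>))\<^sup>2 = (1 - a * cos \<theta>)\<^sup>2 + (a * sin \<theta>)\<^sup>2"
    by (simp add: r12_def dist_prod_def dist_real_def)
  also have "... = a\<^sup>2 * ((sin \<theta>)\<^sup>2 + (cos \<theta>)\<^sup>2) - 2 * a * cos \<theta> + 1"
    by algebra
  finally show ?thesis
    by simp
qed

lemma r23_squared: "(r23 (a, b, c, \<theta>))\<^sup>2 = a\<^sup>2 + 2 * a * b * cos \<theta> + b\<^sup>2"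
proof -
  have "(r23 (a, b, c, \<theta>))\<^sup>2 = (a * cos \<theta> + b)\<^sup>2 + (a * sin \<theta>)\<^sup>2"
    by (simp add: r23_def dist_prod_def dist_real_def)
  also have "... = a\<^sup>2 * ((sin \<theta>)\<^sup>2 + (cos \<theta>)\<^sup>2) + 2 * a * b * cos \<theta> + b\<^sup>2"
    by algebra
  finally show ?thesis
    by simp
qed

lemma r14_squared: "(r14 (a, b, c, \<theta>))\<^sup>2 = c\<^sup>2 + 2 * c * cos \<theta> + 1"
proof -
  have "(r14 (a, b, c, \<theta>))\<^sup>2 = (1 + c * cos \<theta>)\<^sup>2 + (c * sin \<theta>)\<^sup>2"
    by (simp add: r14_def dist_prod_def dist_real_def)
  also have "... = c\<^sup>2 * ((sin \<theta>)\<^sup>2 + (cos \<theta>)\<^sup>2) + 2 * c * cos \<theta> + 1"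
    by algebra
  finally show ?thesis
    by simp
qed

lemma r34_squared: "(r34 (a, b, c, \<theta>))\<^sup>2 = b\<^sup>2 - 2 * b * c * cos \<theta> + c\<^sup>2"
proof -
  have "(r34 (a, b, c, \<theta>))\<^sup>2 = (c * cos \<theta> - b)\<^sup>2 + (c * sin \<theta>)\<^sup>2"
    by (simp add: r34_def dist_prod_def dist_real_def)
  also have "... = c\<^sup>2 * ((sin \<theta>)\<^sup>2 + (cos \<theta>)\<^sup>2) - 2 * b * c * cos \<theta> + b\<^sup>2"
    by algebra
  finally show ?thesis
    by simp
qed

lemma r13_eq: "b > 0 \<Longrightarrow> r13 (a, b, c, \<theta>) = b + 1"
  by (simp add: r13_def dist_prod_def dist_real_def)

lemma r24_eq:
  assumes "a > 0" "c > 0"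
  shows "r24 (a, b, c, \<theta>) = a + c"
proof -
  have "(a * cos \<theta> + c * cos \<theta>)\<^sup>2 + (a * sin \<theta> + c * sin \<theta>)\<^sup>2
      = (a + c)\<^sup>2 * ((sin \<theta>)\<^sup>2 + (cos \<theta>)\<^sup>2)"
    by algebra
  with assms show ?thesis
    by (simp add: r24_def dist_prod_def dist_real_def)
qed

definition ordered_configs :: "coords set"  \<comment> \<open>the set written \<open>\<C>\<close>\<close>
  where "ordered_configs = {(a, b, c, \<theta>).
    a > 0 \<and> b > 0 \<and> c > 0 \<and> 0 < \<theta> \<and> \<theta> < pi \<and>
    (let s = (a, b, c, \<theta>) in
      r13 s > r12 s \<and> r24 s > r12 s \<and>
      r12 s \<ge> r14 s \<and> r14 s \<ge> r34 s \<and>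
      r12 s \<ge> r23 s \<and> r23 s \<ge> r34 s)}"

definition cc_F :: "coords \<Rightarrow> real" where
  "cc_F s =
     (r24 s ^ 3 - r14 s ^ 3) * (r13 s ^ 3 - r12 s ^ 3) * (r23 s ^ 3 - r34 s ^ 3)
   - (r12 s ^ 3 - r14 s ^ 3) * (r24 s ^ 3 - r34 s ^ 3) * (r13 s ^ 3 - r23 s ^ 3)"

definition central_configs :: "coords set"  \<comment> \<open>the set written \<open>E\<close>\<close>
  where "central_configs = {s \<in> ordered_configs. cc_F s = 0}"

definition D1 :: "(real \<times> real \<times> real) set" where
  "D1 = {(a, b, c). a > 0 \<and> b > 0 \<and> c > 0 \<and> c \<le> a \<and> a \<le> 1 \<and> b \<le> 1 \<and>
     1 / 2 * (- a + sqrt (4 - 3 * a\<^sup>2)) < c \<and> c < 1 / a * (b\<^sup>2 + 2 * b) \<and>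
     c > - a + sqrt (a\<^sup>2 + b)}"

definition D2 :: "(real \<times> real \<times> real) set" where
  "D2 = {(a, b, c). a > 0 \<and> b > 0 \<and> c > 0 \<and> c \<le> a \<and> a > 1 \<and> b \<le> 1 \<and>
     c < 1 / a * (b\<^sup>2 + 2 * b) \<and> b > 1 / 2 * (- 1 + sqrt (4 * a\<^sup>2 - 3)) \<and>
     c > - a + sqrt (a\<^sup>2 + b)}"

definition D :: "(real \<times> real \<times> real) set" where "D = D1 \<union> D2"

text \<open>
  The diagonal angle as a function of a, b, c, written f in the mathematical text. The description
  is meaningful where the angle exists and is unique, which is the case on \<open>D\<close>.
\<close>

definition diag_angle :: "real \<Rightarrow> real \<Rightarrow> real \<Rightarrow> real" where
  "diag_angle a b c = (THE \<theta>. 0 < \<theta> \<and> \<theta> < pi \<and> (a, b, c, \<theta>) \<in> central_configs)"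

end

theory Submission
  imports Defs
begin

text \<open>
  All squared distances are affine in \<open>x = cos \<theta>\<close>, so for fixed a, b, c the admissible x form an
  interval, and on the interior of D it is non-degenerate. Write A, B, p, q, s, t for the cubes of
  r24, r13, r14, r12, r34, r23. Where x \<open>\<le>\<close> 0, convexity of \<open>u powr (3 / 2)\<close> gives
  t - s \<open>\<le>\<close> q - p, which forces F < 0; hence every solution has x > 0. There F = 0 says that
  \<open>(A - p) / (q - p) * ((t - s) / (A - s)) * ((B - q) / (B - t)) = 1\<close>,
  and each factor increases with x, so the solution is unique; at the ends of the admissible
  interval F factors and its sign is visible, so the solution exists. At the solution
  \<open>\<partial>F/\<partial>x > 0\<close>, and since x > 0 makes the c-derivative of s at most that of p, also
  \<open>\<partial>F/\<partial>c > 0\<close>. Therefore x decreases and \<open>\<theta> = arccos x\<close> increases with c.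
\<close>

subsection \<open>The equation in terms of cubed lengths\<close>

text \<open>This is \<open>cc_F\<close> with the six cubed lengths as independent variables, so that
  the sign arguments use only inequalities between the cubes.\<close>

definition cc_form :: "real \<Rightarrow> real \<Rightarrow> real \<Rightarrow> real \<Rightarrow> real \<Rightarrow> real \<Rightarrow> real" where
  "cc_form A B p q s t = (A - p) * (B - q) * (t - s) - (q - p) * (A - s) * (B - t)"

text \<open>The bound on \<open>t - s\<close> turns the first product into a multiple of
  \<open>q - p\<close>, and the two products can then be compared factor by factor. Strictness comes
  from \<open>t < q\<close>.\<close>

lemma cc_form_neg:
  assumes "q < A" "q < B" "p < q" "t < q" "s \<le> p" "t - s \<le> q - p"
  shows "cc_form A B p q s t < 0"
proof -
  have "(A - p) * (B - q) * (t - s) \<le> (A - p) * (B - q) * (q - p)"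
    using assms by (intro mult_left_mono) auto
  also have "\<dots> < (A - s) * (B - t) * (q - p)"
    using assms by (intro mult_strict_right_mono mult_le_less_imp_less) auto
  finally show ?thesis
    by (simp add: cc_form_def mult_ac)
qed

text \<open>When a cube becomes equal to \<open>q\<close>, the form splits into differences of
  cubes. The cases \<open>p = q\<close> and \<open>t = q\<close> occur at upper ends of the
  admissible interval, \<open>B = q\<close> and \<open>A = q\<close> at lower ends.\<close>

lemma cc_form_eq_pq: "cc_form A B q q s t = (A - q) * (B - q) * (t - s)"
  by (simp add: cc_form_def)

lemma cc_form_eq_tq: "cc_form A B p q s q = (B - q) * (A - q) * (p - s)"
  unfolding cc_form_def by algebra

lemma cc_form_eq_Bq: "cc_form A q p q s t = - ((q - p) * (A - s) * (q - t))"
  by (simp add: cc_form_def)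

lemma cc_form_eq_Aq: "cc_form q B p q s t = - ((q - p) * (B - s) * (q - t))"
  unfolding cc_form_def by algebra

text \<open>\<open>A\<close> and \<open>B\<close> are shared because only the angle varies. A
  nonnegative form means that the product of three positive quotients is at least 1; each quotient
  grows under the stated changes, and \<open>w\<close> grows strictly.\<close>

lemma cc_form_sgn_mono:
  assumes 1: "q < A" "q < B" "p < q" "t < q" "s < t"
    and 2: "q' < A" "q' < B" "p' < q'" "t' < q'" "s' < t'"
    and le: "q' < q" "p \<le> p'" "t \<le> t'" "s' \<le> s"
    and nonneg: "0 \<le> cc_form A B p q s t"
  shows "0 < cc_form A B p' q' s' t'"
proof -
  define u v w where "u = (A - p) / (q - p)" "v = (t - s) / (A - s)" "w = (B - q) / (B - t)"
  define u' v' w' where "u' = (A - p') / (q' - p')" "v' = (t' - s') / (A - s')"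
    "w' = (B - q') / (B - t')"
  \<comment> \<open>Numerator and denominator of \<open>u\<close> move in the same direction, and so
    do those of \<open>v\<close>. Splitting off 1 leaves quotients in which they move in opposite
    directions.\<close>
  have eq: "u = 1 + (A - q) / (q - p)" "u' = 1 + (A - q') / (q' - p')"
    "v = 1 - (A - t) / (A - s)" "v' = 1 - (A - t') / (A - s')"
    using 1 2 by (simp_all add: u_v_w_def u'_v'_w'_def field_simps)
  have "u \<le> u'" unfolding eq
    using 1 2 le by (intro add_left_mono frac_le) auto
  moreover have "v \<le> v'" unfolding eq
    using 1 2 le by (intro diff_left_mono frac_le) auto
  moreover have "w < w'" unfolding u_v_w_def u'_v'_w'_def
    using 1 2 le by (intro frac_less) auto
  moreover have pos: "u > 0" "v > 0" "w > 0"
    using 1 by (simp_all add: u_v_w_def)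
  ultimately have "u * v * w < u' * v' * w'"
    by (intro mult_le_less_imp_less mult_mono) auto
  moreover have "u * v * w = ((A - p) * (B - q) * (t - s)) / ((q - p) * (A - s) * (B - t))"
    by (simp add: u_v_w_def mult_ac)
  hence "1 \<le> u * v * w"
    using 1 nonneg by (simp add: cc_form_def le_divide_eq)
  ultimately have "1 < u' * v' * w'" by simp
  also have "u' * v' * w' = ((A - p') * (B - q') * (t' - s')) / ((q' - p') * (A - s') * (B - t'))"
    by (simp add: u'_v'_w'_def mult_ac)
  finally show ?thesis
    using 2 by (simp add: cc_form_def less_divide_eq)
qed

text \<open>The conclusion concerns the derivative of \<open>cc_form\<close> in a direction that
  fixes \<open>A\<close> and \<open>B\<close>. The order of the cubes settles the coefficients of
  \<open>dq\<close> and \<open>dt\<close>; those of \<open>dp\<close> and \<open>ds\<close> are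
  \<open>\<alpha>\<close> and \<open>- \<beta>\<close>, whose signs are read off at a zero of the
  form.\<close>

lemma cc_form_deriv_angle_pos:
  assumes ord: "q < A" "q < B" "p < q" "t < q" "s < t"
    and zero: "cc_form A B p q s t = 0"
    and deriv: "0 < dp" "dq < 0" "ds < 0" "0 < dt"
  shows "0 < - dp * (B - q) * (t - s) - dq * (A - p) * (t - s) + (A - p) * (B - q) * (dt - ds)
    - (dq - dp) * (A - s) * (B - t) + ds * (q - p) * (B - t) + dt * (q - p) * (A - s)"
    (is "0 < ?d")
proof -
  have eq: "(A - p) * (B - q) * (t - s) = (q - p) * (A - s) * (B - t)"
    using zero by (simp add: cc_form_def)
  define \<alpha> where "\<alpha> = (A - s) * (B - t) - (B - q) * (t - s)"
  define \<beta> where "\<beta> = (A - p) * (B - q) - (q - p) * (B - t)"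
  \<comment> \<open>Multiplication by a positive difference produces one side of \<open>eq\<close>;
    replacing it by the other side leaves a product of positive differences. The same device serves
    for \<open>\<beta>\<close>.\<close>
  have "\<alpha> * (q - p) = (B - q) * (t - s) * (A - q)"
    using eq unfolding \<alpha>_def by algebra
  hence "\<alpha> * (q - p) > 0" using ord by simp
  hence \<alpha>: "\<alpha> > 0" using ord by (simp add: zero_less_mult_iff)
  have "\<beta> * (t - s) = (q - p) * (B - t) * (A - t)"
    using eq unfolding \<beta>_def by algebra
  hence "\<beta> * (t - s) > 0" using ord by simp
  hence \<beta>: "\<beta> > 0" using ord by (simp add: zero_less_mult_iff)
  have "?d = dp * \<alpha> + (- dq) * ((A - p) * (t - s) + (A - s) * (B - t))
      + dt * ((A - p) * (B - q) + (q - p) * (A - s)) + (- ds) * \<beta>"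
    unfolding \<alpha>_def \<beta>_def by (simp add: algebra_simps)
  also have "\<dots> > 0"
    using ord deriv \<alpha> \<beta> by (intro add_pos_pos mult_pos_pos) auto
  finally show ?thesis .
qed

text \<open>Here \<open>B\<close>, \<open>q\<close> and \<open>t\<close> are fixed, since they do
  not involve c. The derivative is \<open>dA * \<gamma> + dp * \<alpha> - ds * \<beta>\<close>. As
  \<open>ds\<close> may have either sign, it is replaced by its upper bound \<open>dp\<close>, and
  \<open>\<beta> \<le> \<alpha>\<close> then suffices.\<close>

lemma cc_form_deriv_c_pos:
  assumes ord: "q < A" "q < B" "p < q" "t < q" "s < t" "s < p"
    and zero: "cc_form A B p q s t = 0"
    and deriv: "0 < dA" "0 < dp" "ds \<le> dp"
  shows "0 < (dA - dp) * (B - q) * (t - s) - (A - p) * (B - q) * ds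
    + dp * (A - s) * (B - t) - (q - p) * (dA - ds) * (B - t)"
    (is "0 < ?d")
proof -
  have eq: "(A - p) * (B - q) * (t - s) = (q - p) * (A - s) * (B - t)"
    using zero by (simp add: cc_form_def)
  define \<alpha> where "\<alpha> = (A - s) * (B - t) - (B - q) * (t - s)"
  define \<beta> where "\<beta> = (A - p) * (B - q) - (q - p) * (B - t)"
  define \<gamma> where "\<gamma> = (B - q) * (t - s) - (q - p) * (B - t)"
  have "\<gamma> * (A - p) = (q - p) * (B - t) * (p - s)"
    using eq unfolding \<gamma>_def by algebra
  hence "\<gamma> * (A - p) > 0" using ord by simp
  hence \<gamma>: "\<gamma> > 0" using ord by (simp add: zero_less_mult_iff)
  have "\<beta> * (t - s) = (q - p) * (B - t) * (A - t)"
    using eq unfolding \<beta>_def by algebra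
  hence "\<beta> * (t - s) > 0" using ord by simp
  hence \<beta>: "\<beta> > 0" using ord by (simp add: zero_less_mult_iff)
  \<comment> \<open>Both factors grow because \<open>t < q\<close>; expanded and rearranged, this is
    \<open>\<beta> \<le> \<alpha>\<close>.\<close>
  have "(B - q) * ((A - p) + (t - s)) \<le> (B - t) * ((A - s) + (q - p))"
    using ord by (intro mult_mono) auto
  hence "\<beta> \<le> \<alpha>" unfolding \<alpha>_def \<beta>_def by (simp add: algebra_simps)
  have "\<beta> * ds \<le> \<beta> * dp" using \<beta> deriv by simp
  also have "\<dots> \<le> \<alpha> * dp" using \<open>\<beta> \<le> \<alpha>\<close> deriv by simp
  finally have "0 < dA * \<gamma> + \<alpha> * dp - \<beta> * ds"
    using mult_pos_pos[OF \<open>0 < dA\<close> \<gamma>] by linarith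
  also have "\<dots> = ?d" unfolding \<alpha>_def \<beta>_def \<gamma>_def by (simp add: algebra_simps)
  finally show ?thesis .
qed

subsection \<open>Squared lengths as functions of the cosine of the angle\<close>

definition sq12 :: "real \<Rightarrow> real \<Rightarrow> real" where "sq12 a x = a\<^sup>2 - 2 * a * x + 1"
definition sq23 :: "real \<Rightarrow> real \<Rightarrow> real \<Rightarrow> real" where "sq23 a b x = a\<^sup>2 + 2 * a * b * x + b\<^sup>2"
definition sq14 :: "real \<Rightarrow> real \<Rightarrow> real" where "sq14 c x = c\<^sup>2 + 2 * c * x + 1"
definition sq34 :: "real \<Rightarrow> real \<Rightarrow> real \<Rightarrow> real" where "sq34 b c x = b\<^sup>2 - 2 * b * c * x + c\<^sup>2"

lemma sq12_pos: assumes "\<bar>x\<bar> < 1" shows "0 < sq12 a x"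
proof -
  have "sq12 a x = (a - x)\<^sup>2 + (1 - x\<^sup>2)" unfolding sq12_def by algebra
  thus ?thesis using assms by (simp add: add_nonneg_pos abs_square_less_1)
qed

lemma sq14_pos: assumes "\<bar>x\<bar> < 1" shows "0 < sq14 c x"
  using sq12_pos[OF assms, of "- c"] by (simp add: sq12_def sq14_def)

lemma sq34_pos: assumes "\<bar>x\<bar> < 1" "c > 0" shows "0 < sq34 b c x"
proof -
  have "sq34 b c x = (b - c * x)\<^sup>2 + c\<^sup>2 * (1 - x\<^sup>2)" unfolding sq34_def by algebra
  moreover have "c\<^sup>2 * (1 - x\<^sup>2) > 0" using assms by (simp add: abs_square_less_1)
  ultimately show ?thesis by (smt (verit) zero_le_power2)
qed

lemma sq23_pos: assumes "\<bar>x\<bar> < 1" "a > 0" shows "0 < sq23 a b x"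
  using sq34_pos[OF assms, of "- b"] by (simp add: sq23_def sq34_def algebra_simps)

text \<open>Two sides with a common vertex have squared lengths whose difference is divisible by the
  diagonal joining their other ends: \<open>a + c\<close> or \<open>1 + b\<close>. The cofactor is
  affine in x, so comparing such sides is a linear condition on x.\<close>

lemma diff_sq12_sq14: "sq12 a x - sq14 c x = (a + c) * (a - c - 2 * x)"
  unfolding sq12_def sq14_def by algebra
lemma diff_sq12_sq23: "sq12 a x - sq23 a b x = (1 + b) * (1 - b - 2 * a * x)"
  unfolding sq12_def sq23_def by algebra
lemma diff_sq14_sq34: "sq14 c x - sq34 b c x = (1 + b) * (1 - b + 2 * c * x)"
  unfolding sq14_def sq34_def by algebra
lemma diff_sq23_sq34: "sq23 a b x - sq34 b c x = (a + c) * (a - c + 2 * b * x)"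
  unfolding sq23_def sq34_def by algebra

lemma sq_le_iff:
  assumes "a > 0" "b > 0" "c > 0"
  shows "sq14 c x \<le> sq12 a x \<longleftrightarrow> 2 * x \<le> a - c"
    and "sq23 a b x \<le> sq12 a x \<longleftrightarrow> 2 * a * x \<le> 1 - b"
    and "sq34 b c x \<le> sq14 c x \<longleftrightarrow> - (1 - b) \<le> 2 * c * x"
    and "sq34 b c x \<le> sq23 a b x \<longleftrightarrow> - (a - c) \<le> 2 * b * x"
    and "sq12 a x \<le> (b + 1)\<^sup>2 \<longleftrightarrow> a\<^sup>2 - b\<^sup>2 - 2 * b \<le> 2 * a * x"
    and "sq12 a x \<le> (a + c)\<^sup>2 \<longleftrightarrow> 1 - c\<^sup>2 - 2 * a * c \<le> 2 * a * x"
proof -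
  have *: "u \<le> v \<longleftrightarrow> 0 \<le> v - u" for u v :: real by simp
  show "sq14 c x \<le> sq12 a x \<longleftrightarrow> 2 * x \<le> a - c"
    unfolding *[of "sq14 c x"] diff_sq12_sq14 using assms by (simp add: zero_le_mult_iff)
  show "sq23 a b x \<le> sq12 a x \<longleftrightarrow> 2 * a * x \<le> 1 - b"
    unfolding *[of "sq23 a b x"] diff_sq12_sq23 using assms by (simp add: zero_le_mult_iff)
  show "sq34 b c x \<le> sq14 c x \<longleftrightarrow> - (1 - b) \<le> 2 * c * x"
    unfolding *[of "sq34 b c x"] diff_sq14_sq34 using assms by (auto simp add: zero_le_mult_iff)
  show "sq34 b c x \<le> sq23 a b x \<longleftrightarrow> - (a - c) \<le> 2 * b * x"
    unfolding *[of "sq34 b c x"] diff_sq23_sq34 using assms by (auto simp add: zero_le_mult_iff)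
qed (auto simp: sq12_def power2_sum)

lemma sq_less_iff:
  assumes "a > 0" "b > 0" "c > 0"
  shows "sq14 c x < sq12 a x \<longleftrightarrow> 2 * x < a - c"
    and "sq23 a b x < sq12 a x \<longleftrightarrow> 2 * a * x < 1 - b"
    and "sq34 b c x < sq14 c x \<longleftrightarrow> - (1 - b) < 2 * c * x"
    and "sq34 b c x < sq23 a b x \<longleftrightarrow> - (a - c) < 2 * b * x"
    and "sq12 a x < (b + 1)\<^sup>2 \<longleftrightarrow> a\<^sup>2 - b\<^sup>2 - 2 * b < 2 * a * x"
    and "sq12 a x < (a + c)\<^sup>2 \<longleftrightarrow> 1 - c\<^sup>2 - 2 * a * c < 2 * a * x"
proof -
  have *: "u < v \<longleftrightarrow> 0 < v - u" for u v :: real by simp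
  show "sq14 c x < sq12 a x \<longleftrightarrow> 2 * x < a - c"
    unfolding *[of "sq14 c x"] diff_sq12_sq14 using assms by (simp add: zero_less_mult_iff)
  show "sq23 a b x < sq12 a x \<longleftrightarrow> 2 * a * x < 1 - b"
    unfolding *[of "sq23 a b x"] diff_sq12_sq23 using assms by (simp add: zero_less_mult_iff)
  show "sq34 b c x < sq14 c x \<longleftrightarrow> - (1 - b) < 2 * c * x"
    unfolding *[of "sq34 b c x"] diff_sq14_sq34 using assms by (auto simp add: zero_less_mult_iff)
  show "sq34 b c x < sq23 a b x \<longleftrightarrow> - (a - c) < 2 * b * x"
    unfolding *[of "sq34 b c x"] diff_sq23_sq34 using assms by (auto simp add: zero_less_mult_iff)
qed (auto simp: sq12_def power2_sum)

section \<open>Cubed lengths as functions of squared lengths\<close>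

text \<open>The argument is a squared length, so on nonnegative reals this is
  \<open>u powr (3 / 2)\<close>. Since \<open>sqrt\<close> is continuous on all reals, continuity
  holds without sign conditions, which later allows \<open>UNIV\<close> as the domain.\<close>

definition cube_len :: "real \<Rightarrow> real" where "cube_len u = sqrt u ^ 3"

lemma cube_len_le_iff: "0 \<le> u \<Longrightarrow> 0 \<le> v \<Longrightarrow> cube_len u \<le> cube_len v \<longleftrightarrow> u \<le> v"
  by (simp add: cube_len_def)

lemma cube_len_less_iff: "0 \<le> u \<Longrightarrow> 0 \<le> v \<Longrightarrow> cube_len u < cube_len v \<longleftrightarrow> u < v"
  by (metis cube_len_le_iff linorder_not_le)

lemma cube_len_power2: "0 \<le> l \<Longrightarrow> cube_len (l\<^sup>2) = l ^ 3"
  by (simp add: cube_len_def)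

lemma continuous_on_cube_len [continuous_intros]:
  "continuous_on S f \<Longrightarrow> continuous_on S (\<lambda>z. cube_len (f z))"
  unfolding cube_len_def by (intro continuous_intros)

lemma has_derivative_cube_len [derivative_intros]:
  assumes "(u has_derivative u') (at z within S)" "0 < u z"
  shows "((\<lambda>z. cube_len (u z)) has_derivative (\<lambda>h. 3 / 2 * sqrt (u z) * u' h)) (at z within S)"
proof -
  have "(cube_len has_real_derivative 3 / 2 * sqrt (u z)) (at (u z))"
    unfolding cube_len_def using assms(2)
    by (auto intro!: derivative_eq_intros simp: field_simps power2_eq_square)
  from has_derivative_compose[OF assms(1) this[unfolded has_field_derivative_def]]
  show ?thesis by simp
qed

text \<open>This is the convexity of \<open>u powr (3 / 2)\<close>.\<close>

lemma cube_len_diff_mono: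
  assumes "0 < s" "s \<le> t" "s \<le> p" "t \<le> q" "t - s \<le> q - p"
  shows "cube_len t - cube_len s \<le> cube_len q - cube_len p"
proof -
  define k l m n where "k = sqrt p" "l = sqrt q" "m = sqrt s" "n = sqrt t"
  have pos: "k > 0" "l > 0" "m > 0" "n > 0" and le: "m \<le> k" "n \<le> l" "m \<le> n"
    and diff: "n\<^sup>2 - m\<^sup>2 \<le> l\<^sup>2 - k\<^sup>2"
    using assms by (simp_all add: k_l_m_n_def)
  \<comment> \<open>\<open>\<mu> u v\<close> is the secant slope
    \<open>(u^3 - v^3) / (u^2 - v^2)\<close> with the common factor \<open>u - v\<close> cancelled,
    so it also makes sense for \<open>u = v\<close>. It is symmetric and increasing in each
    argument, which is the convexity in question.\<close>
  define \<mu> where "\<mu> u v = (u\<^sup>2 + u * v + v\<^sup>2) / (u + v)" for u v :: real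
  have cub: "u ^ 3 - v ^ 3 = (u\<^sup>2 - v\<^sup>2) * \<mu> u v" if "u > 0" "v > 0" for u v
    using that unfolding \<mu>_def by (simp add: power2_eq_square power3_eq_cube field_simps)
  have mono: "\<mu> u v \<le> \<mu> u' v" if "u > 0" "v > 0" "u \<le> u'" for u u' v
  proof -
    have "0 \<le> (u' - u) * (u' * u + v * (u' + u))" using that by simp
    also have "\<dots> = (u'\<^sup>2 + u' * v + v\<^sup>2) * (u + v) - (u\<^sup>2 + u * v + v\<^sup>2) * (u' + v)"
      by algebra
    finally show ?thesis using that by (simp add: \<mu>_def frac_le_eq divide_le_eq field_simps)
  qed
  have comm: "\<mu> u v = \<mu> v u" for u v unfolding \<mu>_def by (simp add: algebra_simps)
  have "\<mu> n m \<le> \<mu> l k"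
    using mono[of n m l] mono[of m l k] pos le by (simp add: comm)
  moreover have "\<mu> n m > 0" using pos by (simp add: \<mu>_def add_pos_pos)
  moreover have "m\<^sup>2 \<le> n\<^sup>2" using le pos by simp
  ultimately have "n ^ 3 - m ^ 3 \<le> l ^ 3 - k ^ 3"
    unfolding cub[OF pos(4,3)] cub[OF pos(2,1)] using diff by (intro mult_mono) auto
  thus ?thesis by (simp add: cube_len_def k_l_m_n_def)
qed

section \<open>The equation and the ordering conditions in terms of c and the cosine\<close>

text \<open>The sides a and b are parameters; c and x form a single pair so that the implicit
  function argument can be run in the (c, x) plane.\<close>

definition reduced_F :: "real \<Rightarrow> real \<Rightarrow> real \<times> real \<Rightarrow> real" where
  "reduced_F a b z = cc_form ((a + fst z) ^ 3) ((b + 1) ^ 3) (cube_len (sq14 (fst z) (snd z)))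
     (cube_len (sq12 a (snd z))) (cube_len (sq34 b (fst z) (snd z))) (cube_len (sq23 a b (snd z)))"

lemma continuous_on_reduced_F: "continuous_on S (reduced_F a b)"
  unfolding reduced_F_def cc_form_def sq12_def sq23_def sq14_def sq34_def
  by (intro continuous_intros)

lemma distances_nonneg:
  "r12 s \<ge> 0" "r13 s \<ge> 0" "r14 s \<ge> 0" "r23 s \<ge> 0" "r24 s \<ge> 0" "r34 s \<ge> 0"
  by (simp_all only: r12_def r13_def r14_def r23_def r24_def r34_def zero_le_dist)

lemma cc_F_eq_reduced_F:
  assumes "a > 0" "b > 0" "c > 0"
  shows "cc_F (a, b, c, \<theta>) = reduced_F a b (c, cos \<theta>)"
proof -
  have cube: "l ^ 3 = cube_len u" if "l \<ge> 0" "l\<^sup>2 = u" for l u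
    using cube_len_power2[OF that(1)] that(2) by simp
  have "r12 (a, b, c, \<theta>) ^ 3 = cube_len (sq12 a (cos \<theta>))"
    by (rule cube) (simp_all add: distances_nonneg r12_squared sq12_def)
  moreover have "r23 (a, b, c, \<theta>) ^ 3 = cube_len (sq23 a b (cos \<theta>))"
    by (rule cube) (simp_all add: distances_nonneg r23_squared sq23_def)
  moreover have "r14 (a, b, c, \<theta>) ^ 3 = cube_len (sq14 c (cos \<theta>))"
    by (rule cube) (simp_all add: distances_nonneg r14_squared sq14_def)
  moreover have "r34 (a, b, c, \<theta>) ^ 3 = cube_len (sq34 b c (cos \<theta>))"
    by (rule cube) (simp_all add: distances_nonneg r34_squared sq34_def)
  ultimately show ?thesis
    using assms by (simp add: cc_F_def reduced_F_def cc_form_def r13_eq r24_eq)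
qed

text \<open>These are the six conditions of \<open>ordered_configs\<close>, made linear in x: r13 >
  r12, r24 > r12, r12 >= r14, r12 >= r23, r14 >= r34 and r23 >= r34, in this sequence.\<close>

definition admissible :: "real \<Rightarrow> real \<Rightarrow> real \<Rightarrow> real \<Rightarrow> bool" where
  "admissible a b c x \<longleftrightarrow>
     a\<^sup>2 - b\<^sup>2 - 2 * b < 2 * a * x \<and> 1 - c\<^sup>2 - 2 * a * c < 2 * a * x \<and>
     2 * x \<le> a - c \<and> 2 * a * x \<le> 1 - b \<and> - (1 - b) \<le> 2 * c * x \<and> - (a - c) \<le> 2 * b * x"

lemma ordered_configs_iff_admissible:
  assumes "a > 0" "b > 0" "c > 0" "0 < \<theta>" "\<theta> < pi"
  shows "(a, b, c, \<theta>) \<in> ordered_configs \<longleftrightarrow> admissible a b c (cos \<theta>)"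
proof -
  let ?s = "(a, b, c, \<theta>)"
  have le: "u \<le> v \<longleftrightarrow> u\<^sup>2 \<le> v\<^sup>2" if "u \<ge> 0" "v \<ge> 0" for u v :: real
    using that by simp
  have less: "u < v \<longleftrightarrow> u\<^sup>2 < v\<^sup>2" if "u \<ge> 0" "v \<ge> 0" for u v :: real
    using le[OF that(2,1)] by (simp only: not_le[symmetric])
  have sq: "(r12 ?s)\<^sup>2 = sq12 a (cos \<theta>)" "(r23 ?s)\<^sup>2 = sq23 a b (cos \<theta>)"
    "(r14 ?s)\<^sup>2 = sq14 c (cos \<theta>)" "(r34 ?s)\<^sup>2 = sq34 b c (cos \<theta>)"
    "(r13 ?s)\<^sup>2 = (b + 1)\<^sup>2" "(r24 ?s)\<^sup>2 = (a + c)\<^sup>2"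
    using assms by (simp_all add: r12_squared r23_squared r14_squared r34_squared r13_eq r24_eq
        sq12_def sq23_def sq14_def sq34_def)
  have "?s \<in> ordered_configs \<longleftrightarrow>
      r12 ?s < r13 ?s \<and> r12 ?s < r24 ?s \<and> r14 ?s \<le> r12 ?s \<and> r34 ?s \<le> r14 ?s \<and>
      r23 ?s \<le> r12 ?s \<and> r34 ?s \<le> r23 ?s"
    using assms by (simp add: ordered_configs_def Let_def)
  also have "\<dots> \<longleftrightarrow> admissible a b c (cos \<theta>)"
    unfolding le[OF distances_nonneg(3,1)] le[OF distances_nonneg(6,3)] le[OF distances_nonneg(4,1)] le[OF distances_nonneg(6,4)]
      less[OF distances_nonneg(1,2)] less[OF distances_nonneg(1,5)] sq sq_le_iff[OF assms(1-3)] 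
      sq_less_iff[OF assms(1-3)] admissible_def by auto
  finally show ?thesis .
qed


text \<open>The facts about \<open>cc_form\<close> speak of cubes, admissibility speaks of linear
  bounds on x; this equivalence and its strict companion pass between the two.\<close>

lemma cube_le_iff:
  assumes "a > 0" "b > 0" "c > 0" "\<bar>x\<bar> < 1"
  shows "cube_len (sq14 c x) \<le> cube_len (sq12 a x) \<longleftrightarrow> 2 * x \<le> a - c"
    and "cube_len (sq23 a b x) \<le> cube_len (sq12 a x) \<longleftrightarrow> 2 * a * x \<le> 1 - b"
    and "cube_len (sq34 b c x) \<le> cube_len (sq14 c x) \<longleftrightarrow> - (1 - b) \<le> 2 * c * x"
    and "cube_len (sq34 b c x) \<le> cube_len (sq23 a b x) \<longleftrightarrow> - (a - c) \<le> 2 * b * x"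
    and "cube_len (sq12 a x) \<le> (b + 1) ^ 3 \<longleftrightarrow> a\<^sup>2 - b\<^sup>2 - 2 * b \<le> 2 * a * x"
    and "cube_len (sq12 a x) \<le> (a + c) ^ 3 \<longleftrightarrow> 1 - c\<^sup>2 - 2 * a * c \<le> 2 * a * x"
proof -
  have "(b + 1) ^ 3 = cube_len ((b + 1)\<^sup>2)" "(a + c) ^ 3 = cube_len ((a + c)\<^sup>2)"
    using assms by (simp_all add: cube_len_power2)
  note [simp] = this sq12_pos[OF assms(4), THEN less_imp_le] sq14_pos[OF assms(4), THEN less_imp_le]
    sq23_pos[OF assms(4,1), THEN less_imp_le] sq34_pos[OF assms(4,3), THEN less_imp_le]
  show "cube_len (sq14 c x) \<le> cube_len (sq12 a x) \<longleftrightarrow> 2 * x \<le> a - c"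
    "cube_len (sq23 a b x) \<le> cube_len (sq12 a x) \<longleftrightarrow> 2 * a * x \<le> 1 - b"
    "cube_len (sq34 b c x) \<le> cube_len (sq14 c x) \<longleftrightarrow> - (1 - b) \<le> 2 * c * x"
    "cube_len (sq34 b c x) \<le> cube_len (sq23 a b x) \<longleftrightarrow> - (a - c) \<le> 2 * b * x"
    "cube_len (sq12 a x) \<le> (b + 1) ^ 3 \<longleftrightarrow> a\<^sup>2 - b\<^sup>2 - 2 * b \<le> 2 * a * x"
    "cube_len (sq12 a x) \<le> (a + c) ^ 3 \<longleftrightarrow> 1 - c\<^sup>2 - 2 * a * c \<le> 2 * a * x"
    unfolding sq_le_iff[OF assms(1-3), symmetric] by (simp_all add: cube_len_le_iff)
qed

lemma cube_less_iff:
  assumes "a > 0" "b > 0" "c > 0" "\<bar>x\<bar> < 1"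
  shows "cube_len (sq14 c x) < cube_len (sq12 a x) \<longleftrightarrow> 2 * x < a - c"
    and "cube_len (sq23 a b x) < cube_len (sq12 a x) \<longleftrightarrow> 2 * a * x < 1 - b"
    and "cube_len (sq34 b c x) < cube_len (sq14 c x) \<longleftrightarrow> - (1 - b) < 2 * c * x"
    and "cube_len (sq34 b c x) < cube_len (sq23 a b x) \<longleftrightarrow> - (a - c) < 2 * b * x"
    and "cube_len (sq12 a x) < (b + 1) ^ 3 \<longleftrightarrow> a\<^sup>2 - b\<^sup>2 - 2 * b < 2 * a * x"
    and "cube_len (sq12 a x) < (a + c) ^ 3 \<longleftrightarrow> 1 - c\<^sup>2 - 2 * a * c < 2 * a * x"
proof -
  have "(b + 1) ^ 3 = cube_len ((b + 1)\<^sup>2)" "(a + c) ^ 3 = cube_len ((a + c)\<^sup>2)"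
    using assms by (simp_all add: cube_len_power2)
  note [simp] = this sq12_pos[OF assms(4), THEN less_imp_le] sq14_pos[OF assms(4), THEN less_imp_le]
    sq23_pos[OF assms(4,1), THEN less_imp_le] sq34_pos[OF assms(4,3), THEN less_imp_le]
  show "cube_len (sq14 c x) < cube_len (sq12 a x) \<longleftrightarrow> 2 * x < a - c"
    "cube_len (sq23 a b x) < cube_len (sq12 a x) \<longleftrightarrow> 2 * a * x < 1 - b"
    "cube_len (sq34 b c x) < cube_len (sq14 c x) \<longleftrightarrow> - (1 - b) < 2 * c * x"
    "cube_len (sq34 b c x) < cube_len (sq23 a b x) \<longleftrightarrow> - (a - c) < 2 * b * x"
    "cube_len (sq12 a x) < (b + 1) ^ 3 \<longleftrightarrow> a\<^sup>2 - b\<^sup>2 - 2 * b < 2 * a * x"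
    "cube_len (sq12 a x) < (a + c) ^ 3 \<longleftrightarrow> 1 - c\<^sup>2 - 2 * a * c < 2 * a * x"
    unfolding sq_less_iff[OF assms(1-3), symmetric] by (simp_all add: cube_len_less_iff)
qed

subsection \<open>Existence and uniqueness of the diagonal angle\<close>

text \<open>A polynomial form of the conditions defining the interior, common to \<open>D1\<close>
  and \<open>D2\<close>. The last four inequalities say that each of the two lower bounds on x set
  by the diagonals lies below each of the upper bounds \<open>(a - c) / 2\<close> and
  \<open>(1 - b) / (2 * a)\<close>; \<open>c < a\<close> and \<open>b < 1\<close> make these upper
  bounds positive.\<close>

definition region :: "real \<Rightarrow> real \<Rightarrow> real \<Rightarrow> bool" where
  "region a b c \<longleftrightarrow> 0 < b \<and> b < 1 \<and> 0 < c \<and> c < a \<and> a * c < b\<^sup>2 + 2 * b \<and>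
     a\<^sup>2 < b\<^sup>2 + b + 1 \<and> 1 < c\<^sup>2 + a * c + a\<^sup>2 \<and> b < c\<^sup>2 + 2 * a * c"

text \<open>The square roots are removed by squaring. Of the two conditions involving
  \<open>a^2\<close> and a constant 1, one is explicit in each piece and the other follows from the
  position of a relative to 1.\<close>

lemma D_weak_region:
  assumes "(a, b, c) \<in> D"
  shows "0 < b" "b \<le> 1" "0 < c" "c \<le> a" "a * c < b\<^sup>2 + 2 * b"
    "a\<^sup>2 < b\<^sup>2 + b + 1" "1 < c\<^sup>2 + a * c + a\<^sup>2" "b < c\<^sup>2 + 2 * a * c"
proof -
  have sq: "u < v\<^sup>2" if "sqrt u < v" for u v :: real
    using that real_le_rsqrt[of v u] by force
  from assms show *: "0 < b" "b \<le> 1" "0 < c" "c \<le> a"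
    by (auto simp: D_def D1_def D2_def)
  from assms show "a * c < b\<^sup>2 + 2 * b"
    by (auto simp: D_def D1_def D2_def field_simps)
  from assms have "sqrt (a\<^sup>2 + b) < a + c"
    by (auto simp: D_def D1_def D2_def)
  from sq[OF this] show "b < c\<^sup>2 + 2 * a * c"
    by (simp add: power2_sum)
  show "a\<^sup>2 < b\<^sup>2 + b + 1"
  proof (cases "a \<le> 1")
    case True
    hence "a\<^sup>2 \<le> 1" using * by (simp add: power_le_one)
    thus ?thesis using * by (smt (verit) zero_le_power2)
  next
    case False
    with assms have "sqrt (4 * a\<^sup>2 - 3) < 2 * b + 1"
      by (auto simp: D_def D1_def D2_def)
    from sq[OF this] show ?thesis by (simp add: power2_sum power_mult_distrib)
  qed
  show "1 < c\<^sup>2 + a * c + a\<^sup>2"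
  proof (cases "a \<le> 1")
    case True
    with assms have "sqrt (4 - 3 * a\<^sup>2) < 2 * c + a"
      by (auto simp: D_def D1_def D2_def)
    from sq[OF this] show ?thesis by (simp add: power2_sum power_mult_distrib mult.commute)
  next
    case False
    hence "1 < a\<^sup>2" by (simp add: one_less_power)
    moreover have "0 < a * c" using * False by simp
    ultimately show ?thesis by (smt (verit) zero_le_power2)
  qed
qed

text \<open>Openness makes the weak bounds strict: after a small increase of b, or of c, the point
  still lies in \<open>D\<close> and satisfies \<open>b \<le> 1\<close>, respectively
  \<open>c \<le> a\<close>.\<close>

lemma interior_D_region:
  assumes "(a, b, c) \<in> interior D"
  shows "region a b c"
proof -
  from assms obtain e where e: "e > 0" "ball (a, b, c) e \<subseteq> D"
    using mem_interior by blast
  have "(a, b + e / 2, c) \<in> D" "(a, b, c + e / 2) \<in> D"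
    using e by (auto intro!: subsetD[OF e(2)] simp: dist_Pair_Pair dist_real_def)
  from D_weak_region(2)[OF this(1)] D_weak_region(4)[OF this(2)]
  have "b < 1" "c < a" using e by auto
  thus ?thesis
    using D_weak_region[of a b c] assms interior_subset[of D] by (auto simp: region_def)
qed

section \<open>Signs of the equation at the ends of the admissible interval\<close>

text \<open>At a lower end set by a diagonal the form factors; for \<open>x \<le> 0\<close> the
  convexity estimate applies. The result serves both to exclude nonpositive roots and to start the
  intermediate value argument.\<close>

lemma reduced_F_neg:
  assumes reg: "region a b c" and x: "\<bar>x\<bar> < 1"
    and low: "a\<^sup>2 - b\<^sup>2 - 2 * b \<le> 2 * a * x" "1 - c\<^sup>2 - 2 * a * c \<le> 2 * a * x"
      "- (1 - b) \<le> 2 * c * x" "- (a - c) \<le> 2 * b * x"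
    and up: "2 * x < a - c" "2 * a * x < 1 - b"
    and edge: "x \<le> 0 \<or> 2 * a * x = a\<^sup>2 - b\<^sup>2 - 2 * b \<or> 2 * a * x = 1 - c\<^sup>2 - 2 * a * c"
  shows "reduced_F a b (c, x) < 0"
proof -
  have abc: "a > 0" "b > 0" "c > 0" using reg by (auto simp: region_def)
  note le = cube_le_iff[OF abc x] and less = cube_less_iff[OF abc x]
  define p q s t where pqst: "p = cube_len (sq14 c x)" "q = cube_len (sq12 a x)"
    "s = cube_len (sq34 b c x)" "t = cube_len (sq23 a b x)"
  define A B where AB: "A = (a + c) ^ 3" "B = (b + 1) ^ 3"
  have F: "reduced_F a b (c, x) = cc_form A B p q s t"
    by (simp add: reduced_F_def pqst AB)
  have ord: "p < q" "t < q" "s \<le> p" "s \<le> t" "q \<le> A" "q \<le> B"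
    unfolding pqst AB le less using low up by auto
  consider "q = B" | "q = A" | "x \<le> 0" "q < A" "q < B"
    using edge ord cube_le_iff(5,6)[OF abc x] cube_less_iff(5,6)[OF abc x]
    unfolding pqst AB by fastforce
  thus ?thesis
  proof cases
    case 1
    have "0 < (q - p) * (A - s) * (q - t)" using ord by (intro mult_pos_pos) auto
    thus ?thesis unfolding F 1[symmetric] cc_form_eq_Bq by simp
  next
    case 2
    have "0 < (q - p) * (B - s) * (q - t)" using ord by (intro mult_pos_pos) auto
    thus ?thesis unfolding F 2[symmetric] cc_form_eq_Aq by simp
  next
    case 3
    \<comment> \<open>For \<open>x \<le> 0\<close> one has \<open>b * x \<le> 0 \<le> - x\<close>.
      Both differences of squares carry the factor \<open>a + c\<close>, so this compares them, and
      convexity lifts the comparison to cubes.\<close>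
    have "(a + c) * (a - c + 2 * b * x) \<le> (a + c) * (a - c - 2 * x)"
      using abc 3 mult_nonneg_nonpos[of b x] by (intro mult_left_mono) auto
    hence "sq23 a b x - sq34 b c x \<le> sq12 a x - sq14 c x"
      by (simp add: diff_sq12_sq14 diff_sq23_sq34)
    hence "t - s \<le> q - p" unfolding pqst
      using low up sq34_pos[OF x abc(3)] sq_le_iff[OF abc] by (intro cube_len_diff_mono) auto
    thus ?thesis unfolding F using ord 3 by (intro cc_form_neg) auto
  qed
qed

text \<open>At an upper end \<open>q = p\<close> or \<open>q = t\<close>, and the form factors.
  Positivity of x makes \<open>s < p\<close> and \<open>s < t\<close> strict, so no factor
  vanishes.\<close>

lemma reduced_F_pos:
  assumes reg: "region a b c" and x: "0 < x" "x < 1"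
    and low: "a\<^sup>2 - b\<^sup>2 - 2 * b < 2 * a * x" "1 - c\<^sup>2 - 2 * a * c < 2 * a * x"
    and up: "2 * x \<le> a - c" "2 * a * x \<le> 1 - b"
    and edge: "2 * x = a - c \<or> 2 * a * x = 1 - b"
  shows "0 < reduced_F a b (c, x)"
proof -
  have abc: "a > 0" "b > 0" "c > 0" using reg by (auto simp: region_def)
  have x': "\<bar>x\<bar> < 1" using x by simp
  note le = cube_le_iff[OF abc x'] and less = cube_less_iff[OF abc x']
  define p q s t where pqst: "p = cube_len (sq14 c x)" "q = cube_len (sq12 a x)"
    "s = cube_len (sq34 b c x)" "t = cube_len (sq23 a b x)"
  define A B where AB: "A = (a + c) ^ 3" "B = (b + 1) ^ 3"
  have F: "reduced_F a b (c, x) = cc_form A B p q s t"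
    by (simp add: reduced_F_def pqst AB)
  have "0 < 2 * c * x" "0 < 2 * b * x" using abc x by auto
  hence ord: "s < p" "s < t" "p \<le> q" "t \<le> q" "q < A" "q < B"
    unfolding pqst AB le less using low up reg by (auto simp: region_def)
  consider "q = p" | "q = t"
    using edge ord cube_le_iff(1,2)[OF abc x'] cube_less_iff(1,2)[OF abc x']
    unfolding pqst by fastforce
  thus ?thesis
  proof cases
    case 1
    thus ?thesis unfolding F 1[symmetric] cc_form_eq_pq using ord by simp
  next
    case 2
    thus ?thesis unfolding F 2[symmetric] cc_form_eq_tq using ord by simp
  qed
qed

text \<open>The signs just found keep a root away from \<open>x \<le> 0\<close> and from both upper
  ends. The strict bounds give the strict order of the cubes needed for monotonicity and for the
  derivatives.\<close>

lemma admissible_root: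
  assumes "region a b c" "\<bar>x\<bar> < 1" "admissible a b c x" "reduced_F a b (c, x) = 0"
  shows "0 < x" "2 * x < a - c" "2 * a * x < 1 - b"
proof -
  show pos: "0 < x"
  proof (rule ccontr)
    assume "\<not> 0 < x"
    moreover from this have "2 * a * x \<le> 0"
      using assms(1) by (auto simp: region_def mult_le_0_iff)
    ultimately show False
      using reduced_F_neg[OF assms(1,2)] assms by (auto simp: admissible_def region_def)
  qed
  show "2 * x < a - c" "2 * a * x < 1 - b"
    using reduced_F_pos[OF assms(1) pos] assms(2-4) by (fastforce simp: admissible_def)+
qed

text \<open>Going from x to a larger y shrinks r12 and r34 and lengthens r14 and r23, so
  \<open>cc_form_sgn_mono\<close> makes the form positive at y.\<close>

lemma admissible_root_not_less:
  assumes reg: "region a b c"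
    and x: "\<bar>x\<bar> < 1" "admissible a b c x" "reduced_F a b (c, x) = 0"
    and y: "\<bar>y\<bar> < 1" "admissible a b c y" "reduced_F a b (c, y) = 0"
  shows "\<not> x < y"
proof
  assume "x < y"
  have abc: "a > 0" "b > 0" "c > 0" "b < 1" "c < a" using reg by (auto simp: region_def)
  note rx = admissible_root[OF reg x] and ry = admissible_root[OF reg y]
  have "0 < 2 * c * x" "0 < 2 * b * x" "0 < 2 * c * y" "0 < 2 * b * y"
    using rx ry abc by auto
  hence pos: "- (1 - b) < 2 * c * x" "- (a - c) < 2 * b * x"
    "- (1 - b) < 2 * c * y" "- (a - c) < 2 * b * y"
    using abc by linarith+
  have "0 < reduced_F a b (c, y)"
    unfolding reduced_F_def fst_conv snd_conv
  proof (rule cc_form_sgn_mono)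
    show "0 \<le> cc_form ((a + c) ^ 3) ((b + 1) ^ 3) (cube_len (sq14 c x)) (cube_len (sq12 a x))
        (cube_len (sq34 b c x)) (cube_len (sq23 a b x))"
      using x by (simp add: reduced_F_def)
    show "cube_len (sq12 a y) < cube_len (sq12 a x)"
      using \<open>x < y\<close> abc sq12_pos[OF x(1)] sq12_pos[OF y(1)]
      by (subst cube_len_less_iff) (auto simp: sq12_def less_imp_le)
    show "cube_len (sq14 c x) \<le> cube_len (sq14 c y)"
      using \<open>x < y\<close> abc sq14_pos[OF x(1)] sq14_pos[OF y(1)]
      by (subst cube_len_le_iff) (auto simp: sq14_def less_imp_le)
    show "cube_len (sq23 a b x) \<le> cube_len (sq23 a b y)"
      using \<open>x < y\<close> abc sq23_pos[OF x(1)] sq23_pos[OF y(1)]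
      by (subst cube_len_le_iff) (auto simp: sq23_def less_imp_le)
    show "cube_len (sq34 b c y) \<le> cube_len (sq34 b c x)"
      using \<open>x < y\<close> abc sq34_pos[OF x(1)] sq34_pos[OF y(1)]
      by (subst cube_len_le_iff) (auto simp: sq34_def less_imp_le)
  qed (use x y rx ry pos cube_less_iff[OF abc(1-3)] in \<open>simp_all add: admissible_def\<close>)
  thus False using y by simp
qed

lemma admissible_root_unique:
  assumes "region a b c"
    and "\<bar>x\<bar> < 1" "admissible a b c x" "reduced_F a b (c, x) = 0"
    and "\<bar>y\<bar> < 1" "admissible a b c y" "reduced_F a b (c, y) = 0"
  shows "x = y"
  using admissible_root_not_less[OF assms(1) assms(2-4) assms(5-7)]
    admissible_root_not_less[OF assms(1) assms(5-7) assms(2-4)] by linarith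

lemma admissible_root_exists:
  assumes reg: "region a b c"
  obtains x where "0 < x" "x < 1" "admissible a b c x" "reduced_F a b (c, x) = 0"
proof -
  have abc: "a > 0" "b > 0" "c > 0" "b < 1" "c < a" using reg by (auto simp: region_def)
  \<comment> \<open>The values of x where r12 equals r13, r24, r14 and r23, in this order.\<close>
  define l1 l2 u1 u2 where lu: "l1 = (a\<^sup>2 - b\<^sup>2 - 2 * b) / (2 * a)"
    "l2 = (1 - c\<^sup>2 - 2 * a * c) / (2 * a)" "u1 = (a - c) / 2" "u2 = (1 - b) / (2 * a)"
  \<comment> \<open>Including 0 in the maximum makes the two conditions involving r34 automatic on
    the interval, and it is an end at which the form is still known to be negative.\<close>
  define l u where "l = Max {0, l1, l2}" "u = Min {u1, u2}"
  have iff: "l1 \<le> x \<longleftrightarrow> a\<^sup>2 - b\<^sup>2 - 2 * b \<le> 2 * a * x" "l1 < x \<longleftrightarrow> a\<^sup>2 - b\<^sup>2 - 2 * b < 2 * a * x"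
    "l2 \<le> x \<longleftrightarrow> 1 - c\<^sup>2 - 2 * a * c \<le> 2 * a * x" "l2 < x \<longleftrightarrow> 1 - c\<^sup>2 - 2 * a * c < 2 * a * x"
    "x \<le> u1 \<longleftrightarrow> 2 * x \<le> a - c" "x < u1 \<longleftrightarrow> 2 * x < a - c"
    "x \<le> u2 \<longleftrightarrow> 2 * a * x \<le> 1 - b" "x < u2 \<longleftrightarrow> 2 * a * x < 1 - b" for x
    using abc by (auto simp: lu field_simps)
  have eqs: "2 * a * l1 = a\<^sup>2 - b\<^sup>2 - 2 * b" "2 * a * l2 = 1 - c\<^sup>2 - 2 * a * c"
    "2 * u1 = a - c" "2 * a * u2 = 1 - b"
    using abc by (auto simp: lu)
  have "2 * a * u1 = a\<^sup>2 - a * c"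
    using eqs(3) by algebra
  hence "l1 < u1" "l1 < u2" "l2 < u1" "l2 < u2"
    using reg eqs(4) iff(2)[of u1] iff(2)[of u2] iff(4)[of u1] iff(4)[of u2]
    by (auto simp: region_def)
  moreover have "0 < u1" "0 < u2"
    using abc by (auto simp: lu)
  ultimately have "l < u" by (simp add: l_u_def)
  \<comment> \<open>For \<open>a < 1\<close> the bound \<open>u1\<close> is below 1/2, otherwise
    \<open>u2\<close> is; thus x can be the cosine of an angle in the open range.\<close>
  have "u < 1"
  proof (cases "a < 1")
    case True
    hence "u1 < 1" using abc by (simp add: lu)
    thus ?thesis by (simp add: l_u_def)
  next
    case False
    hence "u2 < 1" using abc by (simp add: lu)
    thus ?thesis by (simp add: l_u_def)
  qed
  have side: "- (1 - b) \<le> 2 * c * x" "- (a - c) \<le> 2 * b * x" if "0 \<le> x" for x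
    using that abc by (auto intro: order_trans[of _ 0])
  have l: "0 \<le> l" "l1 \<le> l" "l2 \<le> l" "l = 0 \<or> l = l1 \<or> l = l2"
    by (auto simp: l_u_def max_def)
  have u: "u \<le> u1" "u \<le> u2" "u = u1 \<or> u = u2"
    by (auto simp: l_u_def min_def)
  have neg: "reduced_F a b (c, l) < 0"
  proof (rule reduced_F_neg[OF reg])
    show "l \<le> 0 \<or> 2 * a * l = a\<^sup>2 - b\<^sup>2 - 2 * b \<or> 2 * a * l = 1 - c\<^sup>2 - 2 * a * c"
      using l(4) eqs by auto
  qed (use l u \<open>l < u\<close> \<open>u < 1\<close> side in \<open>auto simp flip: iff\<close>)
  have pos: "0 < reduced_F a b (c, u)"
  proof (rule reduced_F_pos[OF reg])
    show "2 * u = a - c \<or> 2 * a * u = 1 - b"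
      using u(3) eqs by auto
  qed (use l u \<open>l < u\<close> \<open>u < 1\<close> side in \<open>auto simp flip: iff\<close>)
  have "continuous_on {l..u} (\<lambda>x. reduced_F a b (c, x))"
    by (rule continuous_on_compose2[OF continuous_on_reduced_F[of UNIV]])
      (auto intro!: continuous_intros)
  then obtain x where x: "l \<le> x" "x \<le> u" "reduced_F a b (c, x) = 0"
    using IVT'[of "\<lambda>x. reduced_F a b (c, x)" l 0 u] neg pos \<open>l < u\<close> by auto
  \<comment> \<open>Admissibility is strict at the two lower bounds; the root avoids
    \<open>l\<close> because the form is negative there.\<close>
  have "l < x" using x neg by (cases "x = l") auto
  show ?thesis
  proof (rule that)
    show "admissible a b c x"
      unfolding admissible_def using x \<open>l < x\<close> l u side[of x] by (auto simp flip: iff)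
  qed (use x \<open>l < x\<close> \<open>u < 1\<close> l in auto)
qed

text \<open>A root x resolves the definite description: \<open>arccos x\<close> is a witness, and
  uniqueness of the cosine gives uniqueness of the angle because \<open>cos\<close> is injective on
  the range considered.\<close>

lemma diag_angle_eq_arccos:
  assumes reg: "region a b c"
    and x: "\<bar>x\<bar> < 1" "admissible a b c x" "reduced_F a b (c, x) = 0"
  shows "diag_angle a b c = arccos x"
proof -
  have abc: "a > 0" "b > 0" "c > 0" using reg by (auto simp: region_def)
  have iff: "(a, b, c, \<theta>) \<in> central_configs \<longleftrightarrow>
      admissible a b c (cos \<theta>) \<and> reduced_F a b (c, cos \<theta>) = 0" if "0 < \<theta>" "\<theta> < pi" for \<theta>
    using that by (simp add: central_configs_def ordered_configs_iff_admissible[OF abc]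
        cc_F_eq_reduced_F[OF abc])
  have bounds: "0 < arccos x" "arccos x < pi"
    using arccos_lt_bounded[of x] x by auto
  show ?thesis unfolding diag_angle_def
  proof (rule the_equality)
    show "0 < arccos x \<and> arccos x < pi \<and> (a, b, c, arccos x) \<in> central_configs"
      using iff[OF bounds] bounds x by (simp add: abs_le_iff)
  next
    fix \<theta> assume \<theta>: "0 < \<theta> \<and> \<theta> < pi \<and> (a, b, c, \<theta>) \<in> central_configs"
    hence "cos \<theta> < 1" "- 1 < cos \<theta>"
      using cos_monotone_0_pi[of 0 \<theta>] cos_monotone_0_pi[of \<theta> pi] by simp_all
    hence "\<bar>cos \<theta>\<bar> < 1" by linarith
    moreover have "admissible a b c (cos \<theta>)" "reduced_F a b (c, cos \<theta>) = 0"
      using \<theta> iff[of \<theta>] by simp_all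
    ultimately have "cos \<theta> = x" using x by (rule admissible_root_unique[OF reg])
    thus "\<theta> = arccos x" using \<theta> arccos_cos[of \<theta>] by simp
  qed
qed

subsection \<open>Differentiating the implicitly defined angle\<close>

text \<open>An implicit function theorem with differentiability of \<open>\<Phi>\<close> at one
  point. Nearby zeros exist by a sign change in the second variable, and \<open>unique\<close>
  places them on the graph of \<open>\<xi>\<close>; the linear approximation at the point then
  yields the derivative.\<close>

lemma implicit_root_has_derivative:
  fixes \<Phi> :: "real \<times> real \<Rightarrow> real" and \<xi> :: "real \<Rightarrow> real"
  assumes cont: "continuous_on UNIV \<Phi>"
    and der: "(\<Phi> has_derivative L) (at (c, x))"
    and pos: "0 < L (0, 1)" and zero: "\<Phi> (c, x) = 0"
    and unique: "\<forall>\<^sub>F z in nhds (c, x). \<Phi> z = 0 \<longrightarrow> \<xi> (fst z) = snd z"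
  shows "(\<xi> has_real_derivative - L (1, 0) / L (0, 1)) (at c)"
proof -
  define \<alpha> \<beta> where ab: "\<alpha> = L (1, 0)" "\<beta> = L (0, 1)"
  have "linear L" using der has_derivative_linear by blast
  have lin: "L (h, k) = h * \<alpha> + k * \<beta>" for h k
  proof -
    have "L (h, k) = L (h *\<^sub>R (1, 0) + k *\<^sub>R (0, 1))" by simp
    also have "\<dots> = h * \<alpha> + k * \<beta>"
      unfolding ab linear_add[OF \<open>linear L\<close>] linear_scale[OF \<open>linear L\<close>] by simp
    finally show ?thesis .
  qed
  have "\<beta> > 0" using pos ab by simp
  obtain d where d: "d > 0" "\<And>z. dist z (c, x) < d \<Longrightarrow> \<Phi> z = 0 \<Longrightarrow> \<xi> (fst z) = snd z"
    using unique unfolding eventually_nhds_metric by blast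
  have "\<xi> c = x" using d(2)[of "(c, x)"] d(1) zero by simp
  have "((\<lambda>y. (c, y)) has_derivative (\<lambda>k. (0, k))) (at x)"
    by (intro has_derivative_Pair has_derivative_const has_derivative_ident)
  from has_derivative_compose[OF this der]
  have "((\<lambda>y. \<Phi> (c, y)) has_derivative (\<lambda>k. L (0, k))) (at x)" .
  hence "((\<lambda>y. \<Phi> (c, y)) has_real_derivative \<beta>) (at x)"
    by (simp add: has_field_derivative_def lin mult_commute_abs)
  from DERIV_pos_inc_right[OF this \<open>\<beta> > 0\<close>] DERIV_pos_inc_left[OF this \<open>\<beta> > 0\<close>] zero
  obtain d1 d2 where d12: "d1 > 0" "\<And>h. 0 < h \<Longrightarrow> h < d1 \<Longrightarrow> 0 < \<Phi> (c, x + h)"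
    "d2 > 0" "\<And>h. 0 < h \<Longrightarrow> h < d2 \<Longrightarrow> \<Phi> (c, x - h) < 0" by auto
  \<comment> \<open>This contains the continuity of \<open>\<xi>\<close> at c: the opposite signs at
    \<open>x - h\<close> and \<open>x + h\<close> persist for t near c, and the zero between them
    must be \<open>\<xi> t\<close>.\<close>
  have near: "\<forall>\<^sub>F t in nhds c. \<Phi> (t, \<xi> t) = 0 \<and> \<bar>\<xi> t - x\<bar> < e" if "e > 0" for e
  proof -
    \<comment> \<open>Below \<open>d1\<close> and \<open>d2\<close> the signs are known, below
      \<open>d / 2\<close> the zero stays in the ball of uniqueness, and below \<open>e\<close> it
      is as close to x as demanded.\<close>
    define h where "h = min (min d1 d2) (min (d / 2) e) / 2"
    have h: "0 < h" "h < d1" "h < d2" "h < d / 2" "h < e"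
      using d d12 that by (auto simp: h_def)
    have tend: "((\<lambda>t. \<Phi> (t, y)) \<longlongrightarrow> \<Phi> (c, y)) (nhds c)" for y
    proof -
      have "continuous_on UNIV (\<lambda>t. \<Phi> (t, y))"
        by (rule continuous_on_compose2[OF cont]) (auto intro!: continuous_intros)
      thus ?thesis
        using tendsto_at_iff_tendsto_nhds[of "\<lambda>t. \<Phi> (t, y)" c]
        by (simp add: continuous_on_eq_continuous_at isCont_def)
    qed
    have "\<forall>\<^sub>F t in nhds c. dist t c < d / 2"
      using d by (auto simp: eventually_nhds_metric intro!: exI[of _ "d / 2"])
    with order_tendstoD(1)[OF tend d12(2)[OF h(1,2)]] order_tendstoD(2)[OF tend d12(4)[OF h(1,3)]]
    show ?thesis
    proof eventually_elim
      case (elim t)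
      have "continuous_on {x - h..x + h} (\<lambda>y. \<Phi> (t, y))"
        by (rule continuous_on_compose2[OF cont]) (auto intro!: continuous_intros)
      then obtain y where y: "x - h \<le> y" "y \<le> x + h" "\<Phi> (t, y) = 0"
        using IVT'[of "\<lambda>y. \<Phi> (t, y)" "x - h" 0 "x + h"] elim h by auto
      have "dist (t, y) (c, x) \<le> dist t c + dist y x"
        using norm_Pair_le[of "t - c" "y - x"] by (simp add: dist_norm)
      also have "\<dots> < d"
      proof -
        have "dist y x < d / 2" using y h unfolding dist_real_def by linarith
        thus ?thesis using elim(3) by linarith
      qed
      finally have "\<xi> t = y" using d(2)[of "(t, y)"] y by simp
      thus ?case using y h by auto
    qed
  qed
  have "(\<xi> has_derivative (\<lambda>h. - \<alpha> / \<beta> * h)) (at c)"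
    unfolding has_derivative_at_alt
  proof (intro conjI allI impI)
    show "bounded_linear (\<lambda>h. - \<alpha> / \<beta> * h)" by (rule bounded_linear_mult_right)
    fix \<epsilon> :: real assume "\<epsilon> > 0"
    \<comment> \<open>\<open>C\<close> will bound the ratio of the increment of \<open>\<xi>\<close>
      to the increment of its argument.\<close>
    define C where "C = 2 * \<bar>\<alpha>\<bar> / \<beta> + 1"
    have C: "C > 0" using \<open>\<beta> > 0\<close> by (simp add: C_def add_nonneg_pos)
    \<comment> \<open>The bound \<open>\<beta> / 2\<close> lets the increment of
      \<open>\<xi>\<close> be absorbed on the left to obtain the constant \<open>C\<close>; the
      other bound makes the final error at most \<open>\<epsilon>\<close> after division by
      \<open>\<beta>\<close>.\<close>
    define e where "e = min (\<beta> / 2) (\<beta> * \<epsilon> / (1 + C))"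
    have "e > 0" using \<open>\<epsilon> > 0\<close> \<open>\<beta> > 0\<close> C by (simp add: e_def)
    moreover have "e \<le> \<beta> / 2" unfolding e_def by (rule min.cobounded1)
    ultimately have e: "e > 0" "e \<le> \<beta> / 2" .
    have "e \<le> \<beta> * \<epsilon> / (1 + C)" unfolding e_def by (rule min.cobounded2)
    hence eC: "e * (1 + C) \<le> \<beta> * \<epsilon>" using C by (simp add: pos_le_divide_eq)
    obtain r where r: "r > 0" "\<And>z. norm (z - (c, x)) < r \<Longrightarrow>
        norm (\<Phi> z - \<Phi> (c, x) - L (z - (c, x))) \<le> e * norm (z - (c, x))"
      using der e(1) unfolding has_derivative_at_alt by blast
    obtain \<delta> where \<delta>: "\<delta> > 0"
      "\<And>t. dist t c < \<delta> \<Longrightarrow> \<Phi> (t, \<xi> t) = 0 \<and> \<bar>\<xi> t - x\<bar> < r / 2"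
      using near[of "r / 2"] r(1) unfolding eventually_nhds_metric by auto
    show "\<exists>\<delta>>0. \<forall>t. norm (t - c) < \<delta> \<longrightarrow>
        norm (\<xi> t - \<xi> c - - \<alpha> / \<beta> * (t - c)) \<le> \<epsilon> * norm (t - c)"
    proof (intro exI[of _ "min \<delta> (r / 2)"] conjI allI impI)
      show "0 < min \<delta> (r / 2)" using \<delta> r by simp
      fix t assume t: "norm (t - c) < min \<delta> (r / 2)"
      define h k where hk: "h = t - c" "k = \<xi> t - x"
      have root: "\<Phi> (t, \<xi> t) = 0" "\<bar>k\<bar> < r / 2"
        using \<delta>(2)[of t] t by (auto simp: hk dist_real_def)
      have nrm: "norm (h, k) \<le> \<bar>h\<bar> + \<bar>k\<bar>" using norm_Pair_le[of h k] by simp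
      hence "norm (h, k) < r" using root t by (simp add: hk)
      hence "\<bar>h * \<alpha> + k * \<beta>\<bar> \<le> e * norm (h, k)"
        using r(2)[of "(t, \<xi> t)"] by (simp add: root zero hk[symmetric] lin)
      also have "\<dots> \<le> e * (\<bar>h\<bar> + \<bar>k\<bar>)" using nrm e by simp
      finally have est: "\<bar>h * \<alpha> + k * \<beta>\<bar> \<le> e * (\<bar>h\<bar> + \<bar>k\<bar>)" .
      \<comment> \<open>A Lipschitz bound on \<open>k\<close> comes first, since the
        differentiability error still contains \<open>\<bar>k\<bar>\<close>.\<close>
      have "\<beta> * \<bar>k\<bar> = \<bar>(h * \<alpha> + k * \<beta>) - h * \<alpha>\<bar>"
        using \<open>\<beta> > 0\<close> by (simp add: abs_mult)
      also have "\<dots> \<le> e * (\<bar>h\<bar> + \<bar>k\<bar>) + \<bar>\<alpha>\<bar> * \<bar>h\<bar>"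
        using est abs_triangle_ineq4[of "h * \<alpha> + k * \<beta>" "h * \<alpha>"] by (simp add: abs_mult mult.commute)
      also have "\<dots> \<le> \<beta> / 2 * (\<bar>h\<bar> + \<bar>k\<bar>) + \<bar>\<alpha>\<bar> * \<bar>h\<bar>"
        using e by (intro add_right_mono mult_right_mono) auto
      finally have "\<bar>k\<bar> \<le> C * \<bar>h\<bar>"
        using \<open>\<beta> > 0\<close> by (simp add: C_def field_simps)
      hence "e * (\<bar>h\<bar> + \<bar>k\<bar>) \<le> e * ((1 + C) * \<bar>h\<bar>)"
        using e by (intro mult_left_mono) (auto simp: algebra_simps)
      also have "\<dots> \<le> \<beta> * \<epsilon> * \<bar>h\<bar>"
        using mult_right_mono[OF eC, of "\<bar>h\<bar>"] by (simp add: mult.assoc)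
      finally have "\<bar>h * \<alpha> + k * \<beta>\<bar> \<le> \<beta> * (\<epsilon> * \<bar>h\<bar>)" using est by (simp add: mult.assoc)
      moreover have "h * \<alpha> + k * \<beta> = \<beta> * (k - - \<alpha> / \<beta> * h)"
        using \<open>\<beta> > 0\<close> by (simp add: field_simps)
      ultimately have "\<beta> * \<bar>k - - \<alpha> / \<beta> * h\<bar> \<le> \<beta> * (\<epsilon> * \<bar>h\<bar>)"
        using \<open>\<beta> > 0\<close> by (simp add: abs_mult)
      hence "\<bar>k - - \<alpha> / \<beta> * h\<bar> \<le> \<epsilon> * \<bar>h\<bar>"
        using \<open>\<beta> > 0\<close> by (simp only: mult_le_cancel_left_pos)
      thus "norm (\<xi> t - \<xi> c - - \<alpha> / \<beta> * (t - c)) \<le> \<epsilon> * norm (t - c)"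
        by (simp add: hk \<open>\<xi> c = x\<close>)
    qed
  qed
  thus ?thesis unfolding has_field_derivative_def ab .
qed

section \<open>Signs of the partial derivatives at a root\<close>

lemma has_derivative_cc_form:
  assumes "(A has_derivative A') (at z)" "(p has_derivative p') (at z)" "(q has_derivative q') (at z)"
    "(s has_derivative s') (at z)" "(t has_derivative t') (at z)"
  shows "((\<lambda>z. cc_form (A z) B (p z) (q z) (s z) (t z)) has_derivative
    (\<lambda>h. (A' h - p' h) * (B - q z) * (t z - s z) - q' h * (A z - p z) * (t z - s z)
      + (A z - p z) * (B - q z) * (t' h - s' h) - (q' h - p' h) * (A z - s z) * (B - t z)
      - (q z - p z) * (A' h - s' h) * (B - t z) + (q z - p z) * (A z - s z) * t' h)) (at z)"
proof -
  note diffs = has_derivative_diff[OF assms(1,2)] has_derivative_diff[OF has_derivative_const assms(3)]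
    has_derivative_diff[OF assms(5,4)] has_derivative_diff[OF assms(3,2)]
    has_derivative_diff[OF assms(1,4)] has_derivative_diff[OF has_derivative_const assms(5)]
  show ?thesis
    unfolding cc_form_def
    by (rule has_derivative_eq_rhs[OF has_derivative_diff[OF
            has_derivative_mult[OF has_derivative_mult[OF diffs(1,2)] diffs(3)]
            has_derivative_mult[OF has_derivative_mult[OF diffs(4,5)] diffs(6)]]])
      (simp add: fun_eq_iff algebra_simps)
qed

text \<open>\<open>L (1, 0)\<close> and \<open>L (0, 1)\<close> are the partial derivatives in c and
  in x. Evaluating the general product rule on the two unit vectors gives the expressions whose
  signs were found for \<open>cc_form\<close>.\<close>

lemma reduced_F_derivative:
  assumes reg: "region a b c" and x: "\<bar>x\<bar> < 1" "admissible a b c x" "reduced_F a b (c, x) = 0"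
  obtains L where "(reduced_F a b has_derivative L) (at (c, x))" "0 < L (1, 0)" "0 < L (0, 1)"
proof -
  have abc: "a > 0" "b > 0" "c > 0" "b < 1" "c < a" using reg by (auto simp: region_def)
  note root = admissible_root[OF reg x]
  have side: "0 < 2 * c * x" "0 < 2 * b * x" using root abc by auto
  define A where "A = (\<lambda>z :: real \<times> real. (a + fst z) ^ 3)"
  define p where "p = (\<lambda>z :: real \<times> real. cube_len (sq14 (fst z) (snd z)))"
  define q where "q = (\<lambda>z :: real \<times> real. cube_len (sq12 a (snd z)))"
  define s where "s = (\<lambda>z :: real \<times> real. cube_len (sq34 b (fst z) (snd z)))"
  define t where "t = (\<lambda>z :: real \<times> real. cube_len (sq23 a b (snd z)))"
  define B where "B = (b + 1) ^ 3"
  define A' where "A' = (\<lambda>h :: real \<times> real. 3 * (a + c)\<^sup>2 * fst h)"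
  define p' where "p' = (\<lambda>h :: real \<times> real. 3 / 2 * sqrt (sq14 c x) * (2 * (c + x) * fst h + 2 * c * snd h))"
  define q' where "q' = (\<lambda>h :: real \<times> real. 3 / 2 * sqrt (sq12 a x) * (- 2 * a * snd h))"
  define s' where "s' = (\<lambda>h :: real \<times> real. 3 / 2 * sqrt (sq34 b c x) * (2 * (c - b * x) * fst h - 2 * b * c * snd h))"
  define t' where "t' = (\<lambda>h :: real \<times> real. 3 / 2 * sqrt (sq23 a b x) * (2 * a * b * snd h))"
  let ?z = "(c, x)"
  have F: "reduced_F a b = (\<lambda>z. cc_form (A z) B (p z) (q z) (s z) (t z))"
    by (simp add: fun_eq_iff reduced_F_def A_def p_def q_def s_def t_def B_def)
  have dA: "(A has_derivative A') (at ?z)"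
    unfolding A_def A'_def by (auto intro!: derivative_eq_intros simp: fun_eq_iff)
  have "((\<lambda>z. sq14 (fst z) (snd z)) has_derivative (\<lambda>h. 2 * (c + x) * fst h + 2 * c * snd h)) (at ?z)"
    unfolding sq14_def by (auto intro!: derivative_eq_intros simp: fun_eq_iff algebra_simps)
  from has_derivative_cube_len[OF this] have dp: "(p has_derivative p') (at ?z)"
    using sq14_pos[OF x(1)] by (simp add: p_def p'_def)
  have "((\<lambda>z :: real \<times> real. sq12 a (snd z)) has_derivative (\<lambda>h. - 2 * a * snd h)) (at ?z)"
    unfolding sq12_def by (auto intro!: derivative_eq_intros simp: fun_eq_iff algebra_simps)
  from has_derivative_cube_len[OF this] have dq: "(q has_derivative q') (at ?z)"
    using sq12_pos[OF x(1)] by (simp add: q_def q'_def)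
  have "((\<lambda>z. sq34 b (fst z) (snd z)) has_derivative
      (\<lambda>h. 2 * (c - b * x) * fst h - 2 * b * c * snd h)) (at ?z)"
    unfolding sq34_def by (auto intro!: derivative_eq_intros simp: fun_eq_iff algebra_simps)
  from has_derivative_cube_len[OF this] have ds: "(s has_derivative s') (at ?z)"
    using sq34_pos[OF x(1) abc(3)] by (simp add: s_def s'_def)
  have "((\<lambda>z :: real \<times> real. sq23 a b (snd z)) has_derivative (\<lambda>h. 2 * a * b * snd h)) (at ?z)"
    unfolding sq23_def by (auto intro!: derivative_eq_intros simp: fun_eq_iff algebra_simps)
  from has_derivative_cube_len[OF this] have dt: "(t has_derivative t') (at ?z)"
    using sq23_pos[OF x(1) abc(1)] by (simp add: t_def t'_def)
  have ord: "q ?z < A ?z" "q ?z < B" "p ?z < q ?z" "t ?z < q ?z" "s ?z < t ?z" "s ?z < p ?z"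
    using cube_less_iff[OF abc(1-3) x(1)] x(2) root side abc
    by (auto simp: A_def B_def p_def q_def s_def t_def admissible_def)
  have zero: "cc_form (A ?z) B (p ?z) (q ?z) (s ?z) (t ?z) = 0" using x(3) by (simp add: F)
  note sq_pos = sq14_pos[OF x(1), of c] sq12_pos[OF x(1), of a] sq34_pos[OF x(1) abc(3), of b]
    sq23_pos[OF x(1) abc(1), of b]
  show ?thesis
  proof (rule that)
    show "(reduced_F a b has_derivative
      (\<lambda>h. (A' h - p' h) * (B - q ?z) * (t ?z - s ?z) - q' h * (A ?z - p ?z) * (t ?z - s ?z)
      + (A ?z - p ?z) * (B - q ?z) * (t' h - s' h) - (q' h - p' h) * (A ?z - s ?z) * (B - t ?z)
      - (q ?z - p ?z) * (A' h - s' h) * (B - t ?z) + (q ?z - p ?z) * (A ?z - s ?z) * t' h)) (at ?z)"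
      (is "(_ has_derivative ?L) _")
      unfolding F by (rule has_derivative_cc_form[OF dA dp dq ds dt])
    \<comment> \<open>The goal is \<open>s' (1, 0) \<le> p' (1, 0)\<close>. First
      \<open>c - b * x\<close> is enlarged to \<open>c + x\<close>, which is positive, and only then
      is the root enlarged using r34 < r14; in this sequence the sign of \<open>c - b * x\<close>
      does not matter.\<close>
    have "0 \<le> b * x" using abc root by simp
    hence "sqrt (sq34 b c x) * (c - b * x) \<le> sqrt (sq34 b c x) * (c + x)"
      using root sq_pos by (intro mult_left_mono real_sqrt_ge_zero) linarith+
    also have "\<dots> \<le> sqrt (sq14 c x) * (c + x)"
      using sq_less_iff(3)[OF abc(1-3), of x] side root abc by (intro mult_right_mono) auto
    finally have "3 * (sqrt (sq34 b c x) * (c - b * x)) \<le> 3 * (sqrt (sq14 c x) * (c + x))"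
      by (rule mult_left_mono) simp
    also have "\<dots> = p' (1, 0)" by (simp add: p'_def)
    also have "3 * (sqrt (sq34 b c x) * (c - b * x)) = s' (1, 0)" by (simp add: s'_def)
    finally have "s' (1, 0) \<le> p' (1, 0)" .
    moreover have "0 < A' (1, 0)" "0 < p' (1, 0)"
      using abc root sq_pos by (auto simp: A'_def p'_def)
    moreover have "q' (1, 0) = 0" "t' (1, 0) = 0" by (simp_all add: q'_def t'_def)
    ultimately show "0 < ?L (1, 0)"
      using cc_form_deriv_c_pos[OF ord zero, of "A' (1, 0)" "p' (1, 0)" "s' (1, 0)"]
      by (simp add: algebra_simps)
    have "0 < p' (0, 1)" "q' (0, 1) < 0" "s' (0, 1) < 0" "0 < t' (0, 1)" "A' (0, 1) = 0"
      using abc sq_pos by (simp_all add: A'_def p'_def q'_def s'_def t'_def mult_pos_neg)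
    thus "0 < ?L (0, 1)"
      using cc_form_deriv_angle_pos[OF ord(1-5) zero, of "p' (0, 1)" "q' (0, 1)" "s' (0, 1)" "t' (0, 1)"]
      by (simp add: algebra_simps)
  qed
qed

section \<open>Monotonicity of the angle in c\<close>

theorem theorem3p11:
  fixes a b c :: real
  assumes "(a, b, c) \<in> interior D"
  shows "\<exists>d. ((\<lambda>t. diag_angle a b t) has_real_derivative d) (at c) \<and> d > 0"
proof -
  have reg: "region a b c" using assms by (rule interior_D_region)
  obtain x where x: "0 < x" "x < 1" "admissible a b c x" "reduced_F a b (c, x) = 0"
    using admissible_root_exists[OF reg] .
  hence x': "\<bar>x\<bar> < 1" by simp
  note root = admissible_root[OF reg x' x(3,4)]
  obtain L where L: "(reduced_F a b has_derivative L) (at (c, x))" "0 < L (1, 0)" "0 < L (0, 1)"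
    using reduced_F_derivative[OF reg x' x(3,4)] .
  define \<xi> where "\<xi> t = cos (diag_angle a b t)" for t
  \<comment> \<open>Strict bounds make this set open. They include positivity of x, from which the
    conditions involving r34 follow, so every zero in the set is an admissible root and equals the
    cosine of the diagonal angle.\<close>
  define S where "S = {z. region a b (fst z) \<and> 0 < snd z \<and> snd z < 1 \<and>
    a\<^sup>2 - b\<^sup>2 - 2 * b < 2 * a * snd z \<and> 1 - (fst z)\<^sup>2 - 2 * a * fst z < 2 * a * snd z \<and>
    2 * snd z < a - fst z \<and> 2 * a * snd z < 1 - b}"
  have "open S"
    unfolding S_def region_def
    by (intro open_Collect_conj open_Collect_less continuous_intros open_Collect_const)
  moreover have "(c, x) \<in> S"
    using reg x root by (auto simp: S_def admissible_def)
  ultimately have inS: "\<forall>\<^sub>F z in nhds (c, x). z \<in> S"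
    by (rule eventually_nhds_in_open)
  have "\<forall>\<^sub>F z in nhds (c, x). reduced_F a b z = 0 \<longrightarrow> \<xi> (fst z) = snd z"
    using inS
  proof eventually_elim
    case (elim z)
    have "admissible a b (fst z) (snd z)"
      using elim by (auto simp: S_def region_def admissible_def intro: order_trans[of _ 0])
    thus ?case
      using elim diag_angle_eq_arccos[of a b "fst z" "snd z"] by (auto simp: S_def \<xi>_def)
  qed
  from implicit_root_has_derivative[OF continuous_on_reduced_F L(1,3) x(4) this]
  have \<xi>: "(\<xi> has_real_derivative - L (1, 0) / L (0, 1)) (at c)" .
  have "diag_angle a b c = arccos x"
    by (rule diag_angle_eq_arccos[OF reg x' x(3,4)])
  hence "\<xi> c = x" using x by (simp add: \<xi>_def)
  have "(arccos has_real_derivative inverse (- sqrt (1 - x\<^sup>2))) (at (\<xi> c))"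
    unfolding \<open>\<xi> c = x\<close> using x by (intro DERIV_arccos) auto
  from DERIV_chain2[OF this \<xi>]
  have "((\<lambda>t. arccos (\<xi> t)) has_real_derivative
      inverse (- sqrt (1 - x\<^sup>2)) * (- L (1, 0) / L (0, 1))) (at c)" .
  \<comment> \<open>\<open>arccos\<close> undoes \<open>cos\<close> on the diagonal angle once that
    angle is known to be some \<open>arccos y\<close>, which holds wherever \<open>region\<close>
    does; this is an open condition on t, so equality near c suffices for the derivative.\<close>
  moreover have ev: "\<forall>\<^sub>F t in nhds c. arccos (\<xi> t) = diag_angle a b t"
  proof -
    have "open {t. region a b t}"
      unfolding region_def
      by (intro open_Collect_conj open_Collect_less continuous_intros open_Collect_const)
    hence "\<forall>\<^sub>F t in nhds c. region a b t"
      using eventually_nhds_in_open[of "{t. region a b t}" c] reg by simp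
    thus ?thesis
    proof eventually_elim
      case (elim t)
      obtain y where y: "0 < y" "y < 1" "admissible a b t y" "reduced_F a b (t, y) = 0"
        using admissible_root_exists[OF elim] .
      hence "diag_angle a b t = arccos y" by (intro diag_angle_eq_arccos[OF elim]) auto
      thus ?case using y by (simp add: \<xi>_def)
    qed
  qed
  ultimately have "((\<lambda>t. diag_angle a b t) has_real_derivative
      inverse (- sqrt (1 - x\<^sup>2)) * (- L (1, 0) / L (0, 1))) (at c)"
    by (simp only: DERIV_cong_ev[OF refl ev refl])
  \<comment> \<open>The cosine decreases with c and \<open>arccos\<close> is decreasing, so the two
    factors are both negative.\<close>
  moreover have "0 < inverse (- sqrt (1 - x\<^sup>2)) * (- L (1, 0) / L (0, 1))"
    using L x by (intro mult_neg_neg) (auto simp: abs_square_less_1)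
  ultimately show ?thesis by blast
qed

end
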